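(* For integers $k\ge1$ and $N\ge k+2$, $$W_2(N,k)=\theta^2P_{N-2}\,W_2(N-1,k)+\theta\,T_2(N-1,k),$$ with initial condition $W_2(k+1,k)=\theta\,(P_k)!$.
   Context: Let $\theta>0$. $\mathrm{inv}(\pi)$ is the number of pairs $i<j$ with $\pi_i>\pi_j$. $P_n=1+\theta+\cdots+\theta^{n-1}$, $(P_n)!=P_n\cdots P_1$. For $\pi\in S_n$, position $i$ is a left-to-right second maximum if exactly one $j<i$ has $\pi_j>\pi_i$. The strategy $S^2_k$ rejects the first $k$ candidates and then accepts the first subsequent left-to-right second maximum (if any). $\pi\in S_n$ is $k$-pickable if $S^2_k$ selects some position, and $k$-winnable if $S^2_k$ selects a position holding value $n-1$. $T_2(n,k)=\sum_{\pi\in S_n\text{ not }k\text{-pickable}}\theta^{\mathrm{inv}(\pi)}$ and $W_2(n,k)=\sum_{\pi\in S_n\ k\text{-winnable}}\theta^{\mathrm{inv}(\pi)}$. *)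

theory Defs
  imports Complex_Main "HOL-Combinatorics.Permutations"
begin

text \<open>Candidate rankings are permutations \<open>\<pi> permutes {1..n}\<close>, with positions and
  values both counted from 1 and \<open>\<pi> i\<close> the value at position \<open>i\<close>.\<close>

definition inversions :: "nat \<Rightarrow> (nat \<Rightarrow> nat) \<Rightarrow> nat" where
  "inversions n \<pi> = card {(i, j). i \<in> {1..n} \<and> j \<in> {1..n} \<and> i < j \<and> \<pi> i > \<pi> j}"

definition P :: "real \<Rightarrow> nat \<Rightarrow> real" where
  "P \<theta> n = (\<Sum>i<n. \<theta> ^ i)"

definition P_fact :: "real \<Rightarrow> nat \<Rightarrow> real" where
  "P_fact \<theta> n = (\<Prod>i=1..n. P \<theta> i)"

definition second_max :: "(nat \<Rightarrow> nat) \<Rightarrow> nat \<Rightarrow> bool" where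
  "second_max \<pi> i \<longleftrightarrow> card {j. 1 \<le> j \<and> j < i \<and> \<pi> j > \<pi> i} = 1"

text \<open>\<open>selects k n \<pi> i\<close>: the strategy that rejects the first \<open>k\<close> candidates and then accepts
  the first left-to-right second maximum stops at position \<open>i\<close>.\<close>

definition selects :: "nat \<Rightarrow> nat \<Rightarrow> (nat \<Rightarrow> nat) \<Rightarrow> nat \<Rightarrow> bool" where
  "selects k n \<pi> i \<longleftrightarrow>
     k < i \<and> i \<le> n \<and> second_max \<pi> i \<and> (\<forall>j. k < j \<and> j < i \<longrightarrow> \<not> second_max \<pi> j)"

definition pickable :: "nat \<Rightarrow> nat \<Rightarrow> (nat \<Rightarrow> nat) \<Rightarrow> bool" where
  "pickable k n \<pi> \<longleftrightarrow> (\<exists>i. selects k n \<pi> i)"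

definition winnable :: "nat \<Rightarrow> nat \<Rightarrow> (nat \<Rightarrow> nat) \<Rightarrow> bool" where
  "winnable k n \<pi> \<longleftrightarrow> (\<exists>i. selects k n \<pi> i \<and> \<pi> i = n - 1)"

definition T2 :: "real \<Rightarrow> nat \<Rightarrow> nat \<Rightarrow> real" where
  "T2 \<theta> n k = (\<Sum>\<pi> | \<pi> permutes {1..n} \<and> \<not> pickable k n \<pi>. \<theta> ^ inversions n \<pi>)"

definition W2 :: "real \<Rightarrow> nat \<Rightarrow> nat \<Rightarrow> real" where
  "W2 \<theta> n k = (\<Sum>\<pi> | \<pi> permutes {1..n} \<and> winnable k n \<pi>. \<theta> ^ inversions n \<pi>)"

end

theory Submission
  imports Defs
begin

text \<open>Write a permutation of \<open>{1..n+1}\<close> as its last value \<open>v\<close> together with the relative order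
  \<open>\<sigma>\<close> of its first \<open>n\<close> values. Appending \<open>v\<close> creates \<open>n + 1 - v\<close> inversions and does not change
  which positions up to \<open>n\<close> are second maxima. If \<open>\<sigma>\<close> is not pickable, the strategy wins exactly
  when \<open>v = n\<close>, which costs one factor \<open>\<theta>\<close>. If it picks a position of \<open>\<sigma>\<close>, whose value is less
  than \<open>n\<close>, it wins exactly when that value is \<open>n - 1\<close> and is raised to \<open>n\<close>, that is, when
  \<open>v \<le> n - 1\<close>; these \<open>v\<close> contribute \<open>\<theta>\<^sup>2 + \<dots> + \<theta>\<^sup>n = \<theta>\<^sup>2 P\<^bsub>n-1\<^esub>\<close>.
  The initial condition is the same recurrence at \<open>N = k + 1\<close>, because no permutation in \<open>S\<^sub>k\<close>
  is \<open>k\<close>-pickable.\<close>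

section \<open>Appending a last value: bijection and inversions\<close>

text \<open>For v in \<open>{1..Suc n}\<close> this is the cycle n+1 -> v -> v+1 -> ... -> n -> n+1.
  As \<open>\<sigma>\<close> fixes n+1, composing with the cycle raises the values from v on and
  puts v at the end in one step.\<close>

definition cycle_to :: "nat \<Rightarrow> nat \<Rightarrow> nat \<Rightarrow> nat" where
  "cycle_to n v j = (if j = Suc n then v else if v \<le> j \<and> j \<le> n then Suc j else j)"

lemma cycle_to_permutes:
  assumes "v \<in> {1..Suc n}"
  shows "cycle_to n v permutes {1..Suc n}"
proof (rule bij_imp_permutes)
  have "inj_on (cycle_to n v) {1..Suc n}"
    using assms by (auto simp: inj_on_def cycle_to_def split: if_splits)
  moreover have "cycle_to n v ` {1..Suc n} \<subseteq> {1..Suc n}"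
    using assms by (auto simp: cycle_to_def)
  ultimately show "bij_betw (cycle_to n v) {1..Suc n} {1..Suc n}"
    by (simp add: bij_betw_def endo_inj_surj)
  show "cycle_to n v x = x" if "x \<notin> {1..Suc n}" for x
    using assms that by (auto simp: cycle_to_def)
qed

text \<open>The reason why appending keeps the relative order of the first n values; old inversions
  and second maxima are both compared through it.\<close>

lemma cycle_to_less_iff:
  assumes "a \<le> n" "b \<le> n"
  shows "cycle_to n v a < cycle_to n v b \<longleftrightarrow> a < b"
  using assms by (auto simp: cycle_to_def)

lemma permutes_interval_le:
  assumes "\<sigma> permutes {1..n::nat}" "i \<le> n"
  shows "\<sigma> i \<le> n"
  using assms permutes_in_image[OF assms(1), of i] permutes_not_in[OF assms(1), of i]
  by (cases "i = 0") auto

lemma append_permutes: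
  assumes "\<sigma> permutes {1..n}" "v \<in> {1..Suc n}"
  shows "cycle_to n v \<circ> \<sigma> permutes {1..Suc n}"
proof -
  have "\<sigma> permutes {1..Suc n}"
    using assms(1) by (rule permutes_subset) auto
  then show ?thesis
    using cycle_to_permutes[OF assms(2)] by (rule permutes_compose)
qed

lemma append_last:
  assumes "\<sigma> permutes {1..n}"
  shows "cycle_to n v (\<sigma> (Suc n)) = v"
  using permutes_not_in[OF assms, of "Suc n"] by (simp add: cycle_to_def)

text \<open>Injective because the last value of the composite is v, after which the invertible cycle
  cancels.\<close>

lemma bij_betw_append:
  "bij_betw (\<lambda>(v, \<sigma>). cycle_to n v \<circ> \<sigma>) ({1..Suc n} \<times> {\<sigma>. \<sigma> permutes {1..n}})
     {\<pi>. \<pi> permutes {1..Suc n}}"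
proof -
  have inj: "v = w \<and> \<sigma> = \<tau>"
    if v: "v \<in> {1..Suc n}" and s: "\<sigma> permutes {1..n}" and t: "\<tau> permutes {1..n}"
      and eq: "cycle_to n v \<circ> \<sigma> = cycle_to n w \<circ> \<tau>" for v w \<sigma> \<tau>
  proof
    show vw: "v = w"
      using fun_cong[OF eq, of "Suc n"] append_last[OF s] append_last[OF t] by simp
    have "inj (cycle_to n v)"
      using cycle_to_permutes[OF v] by (rule permutes_inj)
    then show "\<sigma> = \<tau>"
      using eq vw by (simp add: fun.inj_map_strong fun_eq_iff inj_eq)
  qed
  have surj: "\<exists>v \<sigma>. v \<in> {1..Suc n} \<and> \<sigma> permutes {1..n} \<and> \<pi> = cycle_to n v \<circ> \<sigma>"
    if p: "\<pi> permutes {1..Suc n}" for \<pi>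
  proof -
    \<comment> \<open>The last value dictates which cycle to undo; once it is undone, n+1 is fixed
      and a permutation of \<open>{1..n}\<close> remains.\<close>
    define v where "v = \<pi> (Suc n)"
    define \<sigma> where "\<sigma> = inv (cycle_to n v) \<circ> \<pi>"
    have v: "v \<in> {1..Suc n}"
      using permutes_in_image[OF p, of "Suc n"] by (simp add: v_def)
    note c = cycle_to_permutes[OF v]
    have s: "\<sigma> permutes {1..Suc n}"
      unfolding \<sigma>_def using p permutes_inv[OF c] by (rule permutes_compose)
    have "\<sigma> (Suc n) = inv (cycle_to n v) (cycle_to n v (Suc n))"
      by (simp add: \<sigma>_def v_def cycle_to_def)
    then have last: "\<sigma> (Suc n) = Suc n"
      using permutes_inverses(2)[OF c] by simp
    have "\<sigma> permutes {1..n}"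
      by (rule permutes_superset[OF s]) (use last in \<open>auto simp: le_Suc_eq\<close>)
    moreover have "\<pi> = cycle_to n v \<circ> \<sigma>"
      using permutes_inverses(1)[OF c] by (simp add: \<sigma>_def fun_eq_iff)
    ultimately show ?thesis
      using v by blast
  qed
  have "inj_on (\<lambda>(v, \<sigma>). cycle_to n v \<circ> \<sigma>) ({1..Suc n} \<times> {\<sigma>. \<sigma> permutes {1..n}})"
    by (rule inj_onI) (clarify, blast dest: inj)
  moreover have "(\<lambda>(v, \<sigma>). cycle_to n v \<circ> \<sigma>) ` ({1..Suc n} \<times> {\<sigma>. \<sigma> permutes {1..n}})
      = {\<pi>. \<pi> permutes {1..Suc n}}" (is "?f ` ?D = ?R")
  proof (intro equalityI subsetI)
    fix \<pi> assume "\<pi> \<in> ?R"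
    then obtain v \<sigma> where "(v, \<sigma>) \<in> ?D" "\<pi> = ?f (v, \<sigma>)"
      using surj[of \<pi>] by auto
    then show "\<pi> \<in> ?f ` ?D" by (metis imageI)
  qed (use append_permutes in \<open>fastforce simp del: atLeastAtMost_iff\<close>)
  ultimately show ?thesis by (rule bij_betw_imageI)
qed

lemma sum_permutes_append:
  fixes h :: "(nat \<Rightarrow> nat) \<Rightarrow> 'a :: comm_monoid_add"
  shows "(\<Sum>\<pi> | \<pi> permutes {1..Suc n}. h \<pi>)
    = (\<Sum>v = 1..Suc n. \<Sum>\<sigma> | \<sigma> permutes {1..n}. h (cycle_to n v \<circ> \<sigma>))"
  using sum.reindex_bij_betw[OF bij_betw_append, of h n, symmetric]
  unfolding sum.cartesian_product case_prod_unfold .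

text \<open>Old pairs keep their order. A new pair \<open>(i, Suc n)\<close> is inverted exactly
  when \<open>\<sigma> i\<close> lies in \<open>{v..n}\<close>, and \<open>\<sigma>\<close> takes
  each of these values once.\<close>

lemma inversions_append:
  assumes s: "\<sigma> permutes {1..n}" and v: "v \<in> {1..Suc n}"
  shows "inversions (Suc n) (cycle_to n v \<circ> \<sigma>) = inversions n \<sigma> + (Suc n - v)"
proof -
  let ?\<pi> = "cycle_to n v \<circ> \<sigma>"
  let ?A = "{(i, j). i \<in> {1..n} \<and> j \<in> {1..n} \<and> i < j \<and> \<sigma> i > \<sigma> j}"
  let ?B = "{i \<in> {1..n}. v \<le> \<sigma> i}"
  note le = permutes_interval_le[OF s]
  have cmp: "?\<pi> i > ?\<pi> j \<longleftrightarrow> \<sigma> i > \<sigma> j" if "i \<le> n" "j \<le> n" for i j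
    using cycle_to_less_iff le that by simp
  have new: "?\<pi> i > ?\<pi> (Suc n) \<longleftrightarrow> v \<le> \<sigma> i" if "i \<le> n" for i
    using append_last[OF s] le[OF that] by (auto simp: cycle_to_def)
  have "{(i, j). i \<in> {1..Suc n} \<and> j \<in> {1..Suc n} \<and> i < j \<and> ?\<pi> i > ?\<pi> j}
      = ?A \<union> (\<lambda>i. (i, Suc n)) ` ?B" (is "?L = ?R")
  proof (intro set_eqI iffI)
    fix x assume "x \<in> ?L"
    then obtain i j where x: "x = (i, j)" "1 \<le> i" "i < j" "j \<le> Suc n" "?\<pi> i > ?\<pi> j"
      by auto
    show "x \<in> ?R"
    proof (cases "j = Suc n")
      case True
      then show ?thesis using x new[of i] by auto
    next
      case False
      then show ?thesis using x cmp[of i j] by auto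
    qed
  next
    fix x assume "x \<in> ?R"
    then show "x \<in> ?L"
    proof
      assume "x \<in> ?A"
      then show ?thesis using cmp by auto
    next
      assume "x \<in> (\<lambda>i. (i, Suc n)) ` ?B"
      then show ?thesis using new by auto
    qed
  qed
  moreover have "finite ?A"
    by (rule finite_subset[of _ "{1..n} \<times> {1..n}"]) auto
  moreover have "card ((\<lambda>i. (i, Suc n)) ` ?B) = card ?B"
    by (rule card_image) (auto simp: inj_on_def)
  moreover have "card ?B = Suc n - v"
  proof -
    have "\<sigma> ` ?B = {v..n}"
    proof (intro equalityI subsetI)
      fix y assume "y \<in> \<sigma> ` ?B"
      then show "y \<in> {v..n}" using le by (elim imageE) simp
    next
      fix y assume y: "y \<in> {v..n}"
      then have "y \<in> {1..n}" using v by simp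
      then have "y \<in> \<sigma> ` {1..n}" by (simp only: permutes_image[OF s])
      then obtain x where "x \<in> {1..n}" "y = \<sigma> x" by (elim imageE)
      then show "y \<in> \<sigma> ` ?B" using y by (intro image_eqI[of _ _ x]) simp_all
    qed
    then show ?thesis
      using card_image[OF permutes_inj_on[OF s], of ?B] by simp
  qed
  moreover have "?A \<inter> (\<lambda>i. (i, Suc n)) ` ?B = {}"
    by auto
  ultimately show ?thesis
    unfolding inversions_def by (simp add: card_Un_disjoint)
qed

section \<open>The strategy under appending\<close>

lemma second_max_append:
  assumes "\<sigma> permutes {1..n}" "i \<le> n"
  shows "second_max (cycle_to n v \<circ> \<sigma>) i \<longleftrightarrow> second_max \<sigma> i"
proof -
  have "{j. 1 \<le> j \<and> j < i \<and> (cycle_to n v \<circ> \<sigma>) j > (cycle_to n v \<circ> \<sigma>) i}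
      = {j. 1 \<le> j \<and> j < i \<and> \<sigma> j > \<sigma> i}"
    using cycle_to_less_iff permutes_interval_le[OF assms(1)] assms(2) by auto
  then show ?thesis by (simp add: second_max_def)
qed

text \<open>Whether the strategy stops at i depends only on second maxima up to i, so for
  \<open>i \<le> n\<close> the longer horizon changes nothing.\<close>

lemma selects_append:
  assumes "\<sigma> permutes {1..n}" "i \<le> n"
  shows "selects k (Suc n) (cycle_to n v \<circ> \<sigma>) i \<longleftrightarrow> selects k n \<sigma> i"
proof -
  have "second_max (cycle_to n v \<circ> \<sigma>) j \<longleftrightarrow> second_max \<sigma> j" if "j \<le> i" for j
    using second_max_append[OF assms(1)] assms(2) that by simp
  then show ?thesis
    using assms(2) by (auto simp: selects_def simp del: o_apply)
qed

lemma not_pickable_iff: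
  "\<not> pickable k n \<pi> \<longleftrightarrow> (\<forall>i. k < i \<and> i \<le> n \<longrightarrow> \<not> second_max \<pi> i)"
proof
  assume np: "\<not> pickable k n \<pi>"
  show "\<forall>i. k < i \<and> i \<le> n \<longrightarrow> \<not> second_max \<pi> i"
  proof (rule ccontr)
    assume "\<not> (\<forall>i. k < i \<and> i \<le> n \<longrightarrow> \<not> second_max \<pi> i)"
    then obtain i where i: "k < i \<and> i \<le> n \<and> second_max \<pi> i" by blast
    \<comment> \<open>The least second maximum after k is where the strategy stops.\<close>
    let ?m = "LEAST i. k < i \<and> i \<le> n \<and> second_max \<pi> i"
    have "selects k n \<pi> ?m"
      using LeastI[of "\<lambda>i. k < i \<and> i \<le> n \<and> second_max \<pi> i", OF i]
        not_less_Least[of _ "\<lambda>i. k < i \<and> i \<le> n \<and> second_max \<pi> i"]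
      unfolding selects_def by (meson less_le_trans less_imp_le)
    with np show False by (auto simp: pickable_def)
  qed
qed (auto simp: pickable_def selects_def)

text \<open>Some earlier value is larger and itself at most n. Hence a picked value is never n
  before appending.\<close>

lemma second_max_less:
  assumes "\<sigma> permutes {1..n}" "second_max \<sigma> i" "i \<le> n"
  shows "\<sigma> i < n"
proof -
  have "{j. 1 \<le> j \<and> j < i \<and> \<sigma> j > \<sigma> i} \<noteq> {}"
    using assms(2) unfolding second_max_def by (metis card.empty zero_neq_one)
  then obtain j where "j < i" "\<sigma> j > \<sigma> i" by auto
  then show ?thesis
    using permutes_interval_le[OF assms(1), of j] assms(3) by simp
qed

text \<open>The only value above the appended n is n+1, the raised old maximum, which stands at
  position \<open>inv \<sigma> n\<close>.\<close>

lemma second_max_append_last: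
  assumes s: "\<sigma> permutes {1..n}" and n: "n \<ge> 1"
  shows "second_max (cycle_to n n \<circ> \<sigma>) (Suc n)"
proof -
  have "{j. 1 \<le> j \<and> j < Suc n \<and> (cycle_to n n \<circ> \<sigma>) j > (cycle_to n n \<circ> \<sigma>) (Suc n)}
      = {inv \<sigma> n}" (is "?L = _")
  proof -
    have "j \<in> ?L \<longleftrightarrow> 1 \<le> j \<and> j \<le> n \<and> \<sigma> j = n" for j
      using append_last[OF s, of n] permutes_interval_le[OF s, of j]
      by (auto simp: cycle_to_def)
    moreover have "1 \<le> inv \<sigma> n \<and> inv \<sigma> n \<le> n"
      using permutes_in_image[OF permutes_inv[OF s], of n] n by simp
    ultimately show ?thesis
      using permutes_inverses[OF s] by auto
  qed
  then show ?thesis by (simp add: second_max_def)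
qed

lemma winnable_append:
  assumes s: "\<sigma> permutes {1..n}" and n: "n \<ge> 1" "k \<le> n"
  shows "winnable k (Suc n) (cycle_to n v \<circ> \<sigma>)
    \<longleftrightarrow> v = n \<and> \<not> pickable k n \<sigma> \<or> v < n \<and> winnable k n \<sigma>"
proof -
  let ?\<pi> = "cycle_to n v \<circ> \<sigma>"
  have "i \<le> Suc n" if "selects k (Suc n) ?\<pi> i" for i
    using that by (simp add: selects_def)
  \<comment> \<open>The winning value for horizon n+1 is n. Stops at positions up to n are separated
    from a stop at the last one.\<close>
  then have "winnable k (Suc n) ?\<pi> \<longleftrightarrow> (\<exists>i\<le>Suc n. selects k (Suc n) ?\<pi> i \<and> ?\<pi> i = n)"
    unfolding winnable_def by auto
  also have "\<dots> \<longleftrightarrow> (\<exists>i\<le>n. selects k (Suc n) ?\<pi> i \<and> ?\<pi> i = n)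
      \<or> selects k (Suc n) ?\<pi> (Suc n) \<and> ?\<pi> (Suc n) = n"
    unfolding le_Suc_eq by blast
  finally have split: "winnable k (Suc n) ?\<pi> \<longleftrightarrow>
      (\<exists>i\<le>n. selects k n \<sigma> i \<and> cycle_to n v (\<sigma> i) = n)
      \<or> selects k (Suc n) ?\<pi> (Suc n) \<and> v = n"
    using selects_append[OF s, of _ k v] append_last[OF s, of v] by (simp cong: conj_cong)
  have early: "(\<exists>i\<le>n. selects k n \<sigma> i \<and> cycle_to n v (\<sigma> i) = n) \<longleftrightarrow> v < n \<and> winnable k n \<sigma>"
  proof -
    have "cycle_to n v (\<sigma> i) = n \<longleftrightarrow> v < n \<and> \<sigma> i = n - 1" if "selects k n \<sigma> i" for i
    proof -
      have "\<sigma> i < n" using that second_max_less[OF s] by (auto simp: selects_def)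
      then show ?thesis by (auto simp: cycle_to_def)
    qed
    then show ?thesis unfolding winnable_def by (auto simp: selects_def)
  qed
  \<comment> \<open>For v = n the last position is a second maximum, so the strategy reaches it
    exactly when nothing was picked before.\<close>
  have late: "selects k (Suc n) ?\<pi> (Suc n) \<longleftrightarrow> \<not> pickable k n \<sigma>" if "v = n"
    using second_max_append_last[OF s n(1)] second_max_append[OF s, of _ v] n(2) that
    unfolding selects_def not_pickable_iff by (auto simp: less_Suc_eq_le simp del: o_apply)
  show ?thesis using split early late by blast
qed

section \<open>Weighted sums and the recurrence\<close>

text \<open>The classical inversion generating function: summing over the last value gives the
  geometric factor \<open>P \<theta> (Suc n)\<close>. It evaluates
  \<open>T2 \<theta> k k\<close>.\<close>

lemma sum_inversions: "(\<Sum>\<pi> | \<pi> permutes {1..n}. \<theta> ^ inversions n \<pi>) = P_fact \<theta> n"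
proof (induction n)
  case 0
  then show ?case by (simp add: inversions_def P_fact_def)
next
  case (Suc n)
  have "(\<Sum>\<pi> | \<pi> permutes {1..Suc n}. \<theta> ^ inversions (Suc n) \<pi>)
      = (\<Sum>v = 1..Suc n. \<Sum>\<sigma> | \<sigma> permutes {1..n}. \<theta> ^ (Suc n - v) * \<theta> ^ inversions n \<sigma>)"
    unfolding sum_permutes_append
    by (intro sum.cong refl) (simp add: inversions_append power_add del: atLeastAtMost_iff)
  also have "\<dots> = (\<Sum>v = 1..Suc n. \<theta> ^ (Suc n - v)) * P_fact \<theta> n"
    by (simp only: sum_distrib_left[symmetric] sum_distrib_right[symmetric] Suc.IH)
  also have "(\<Sum>v = 1..Suc n. \<theta> ^ (Suc n - v)) = P \<theta> (Suc n)"
    unfolding P_def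
    by (rule sum.reindex_bij_witness[of _ "\<lambda>i. Suc n - i" "\<lambda>v. Suc n - v"]) auto
  finally show ?case by (simp add: P_fact_def)
qed

lemma W2_Suc:
  assumes n: "n \<ge> 1" "k \<le> n"
  shows "W2 \<theta> (Suc n) k = \<theta>\<^sup>2 * P \<theta> (n - 1) * W2 \<theta> n k + \<theta> * T2 \<theta> n k"
proof -
  let ?S = "{\<sigma>. \<sigma> permutes {1..n}}"
  have fin: "finite {\<pi>. \<pi> permutes {1..m::nat}}" for m
    by (simp add: finite_permutations)
  \<comment> \<open>Moving the condition into the summand makes the sum range over all permutations,
    as the bijection requires.\<close>
  have W2_alt: "W2 \<theta> m k = (\<Sum>\<pi> | \<pi> permutes {1..m}.
      if winnable k m \<pi> then \<theta> ^ inversions m \<pi> else 0)" for m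
    unfolding W2_def using sum.inter_filter[OF fin, where P = "winnable k m"] by simp
  have T2_alt: "T2 \<theta> n k = (\<Sum>\<pi>\<in>?S. if \<not> pickable k n \<pi> then \<theta> ^ inversions n \<pi> else 0)"
    unfolding T2_def using sum.inter_filter[OF fin, where P = "\<lambda>\<pi>. \<not> pickable k n \<pi>"] by simp
  \<comment> \<open>\<open>F v\<close> is the contribution of last value v; the cases are v < n, v =
    n and v = n+1.\<close>
  define F where "F v = (\<Sum>\<sigma>\<in>?S. if winnable k (Suc n) (cycle_to n v \<circ> \<sigma>)
    then \<theta> ^ inversions (Suc n) (cycle_to n v \<circ> \<sigma>) else 0)" for v
  have low: "F v = \<theta> ^ (Suc n - v) * W2 \<theta> n k" if "v \<in> {1..n - 1}" for v
    unfolding F_def W2_alt sum_distrib_left using that n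
    by (intro sum.cong refl)
      (auto simp: winnable_append inversions_append simp del: o_apply simp flip: power_add
        intro!: arg_cong[of _ _ "\<lambda>m. \<theta> ^ m"])
  have mid: "F n = \<theta> * T2 \<theta> n k"
    unfolding F_def T2_alt sum_distrib_left using n
    by (intro sum.cong refl)
      (auto simp: winnable_append inversions_append simp del: o_apply)
  \<comment> \<open>A last value n+1 is a new maximum: it is not a second maximum, and earlier picks
    are not raised, so they stay below n.\<close>
  have top: "F (Suc n) = 0"
    unfolding F_def using n
    by (intro sum.neutral) (auto simp: winnable_append simp del: o_apply)
  have "{1..Suc n} = insert (Suc n) (insert n {1..n - 1})"
    using n by auto
  then have "W2 \<theta> (Suc n) k = (\<Sum>v = 1..n - 1. F v) + F n + F (Suc n)"
    unfolding W2_alt[of "Suc n"] sum_permutes_append F_def[symmetric] using n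
    by (simp add: algebra_simps)
  moreover have "(\<Sum>v = 1..n - 1. F v) = (\<Sum>v = 1..n - 1. \<theta> ^ (Suc n - v)) * W2 \<theta> n k"
    using low by (simp add: sum_distrib_right)
  \<comment> \<open>With i = n-1-v the exponent n+1-v becomes 2+i, and i runs over 0..n-2.\<close>
  moreover have "(\<Sum>v = 1..n - 1. \<theta> ^ (Suc n - v)) = \<theta>\<^sup>2 * P \<theta> (n - 1)"
    unfolding P_def sum_distrib_left power_add[symmetric] using n
    by (intro sum.reindex_bij_witness[of _ "\<lambda>i. n - 1 - i" "\<lambda>v. n - 1 - v"])
      (auto intro!: arg_cong[of _ _ "\<lambda>m. \<theta> ^ m"] simp del: power_Suc)
  ultimately show ?thesis
    using mid top by simp
qed

theorem theorem7:
  fixes \<theta> :: real and k :: nat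
  assumes "\<theta> > 0" and "k \<ge> 1"
  shows "(\<forall>N. N \<ge> k + 2 \<longrightarrow>
            W2 \<theta> N k = \<theta>\<^sup>2 * P \<theta> (N - 2) * W2 \<theta> (N - 1) k + \<theta> * T2 \<theta> (N - 1) k)
         \<and> W2 \<theta> (k + 1) k = \<theta> * P_fact \<theta> k"
proof (intro conjI allI impI)
  fix N assume "N \<ge> k + 2"
  then obtain n where "N = Suc n" "n \<ge> 1" "k \<le> n"
    by (cases N) auto
  then show "W2 \<theta> N k = \<theta>\<^sup>2 * P \<theta> (N - 2) * W2 \<theta> (N - 1) k + \<theta> * T2 \<theta> (N - 1) k"
    using W2_Suc[of n k \<theta>] by (simp add: numeral_2_eq_2)
next
  \<comment> \<open>At n = k every candidate has been rejected: the win term vanishes and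
    \<open>T2\<close> sums over all of S_k.\<close>
  have "W2 \<theta> k k = 0"
    unfolding W2_def by (rule sum.neutral) (auto simp: winnable_def selects_def)
  moreover have "T2 \<theta> k k = P_fact \<theta> k"
    unfolding T2_def sum_inversions[symmetric]
    by (rule sum.cong) (auto simp: not_pickable_iff)
  ultimately show "W2 \<theta> (k + 1) k = \<theta> * P_fact \<theta> k"
    using W2_Suc[of k k \<theta>] assms(2) by simp
qed

end
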